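(* Let $K$ be a radically closed field of characteristic $0$ and $L$ an extension field of $K$. (a) Suppose that $P(X)\in K[X]$, a polynomial of degree $n$, has a $(q,r)$ decomposition in $L[X]$. Then $P$ has a unique normal $(q,r)$ decomposition $P(X)=Q(X)\circ R(X)$. Moreover, $Q$ and $R$ are polynomials in $K[X]$. (b) If $Q\circ R$ is the normal $(q,r)$ decomposition of $P\in K[X]$, then: (b1) $P$ is a $\mu$-polynomial (respectively a $\nu$-polynomial) if and only if $Q$ is a $\mu$-polynomial (respectively a $\nu$-polynomial); (b2) $P$ is a $\varrho$-polynomial if and only if $R$ is a $\varrho$-polynomial. In this case, if $R(X)\ne X^r$, then $P$ and $R$ have the same descent $\Delta$.
   Context: $K$ is radically closed: every polynomial $X^n-a$ ($a\in K$, $n\ge 2$) splits over $K$. For $P\in K[X]$, a $(q,r)$ decomposition of $P$ in $L[X]$ is an equality $P=Q\circ R$ with $Q,R\in L[X]$, $\deg Q=q\ge 2$, $\deg R=r\ge 2$. It is normal if $R$ is a $\mu\nu$-polynomial, i.e. both a $\mu$- and a $\nu$-polynomial. A non-constant polynomial is a $\mu$-polynomial if it is monic; a $\nu$-polynomial if $0$ is one of its roots; a $\varrho$-polynomial if it has the form $a_dX^d$ with $a_d\ne 0$, or $a_dX^d+a_eX^e+a_{e-1}X^{e-1}+\dots+a_1X$ with $a_d,a_e\ne 0$ and $1\le e\le d-2$. The descent of a $\varrho$-polynomial is $d$ in the first case and $d-e$ in the second case.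
   Formalization: In (b2), "R a ϱ-polynomial implies P a ϱ-polynomial" is stated only when P is a ν-polynomial, since it fails otherwise (P=X^4+1, Q=X^2+1, R=X^2); equal descent is stated when P is a ϱ-polynomial and R≠X^r. *)

theory Defs
  imports Subresultants.More_Homomorphisms
begin

definition splits :: "'a::field poly \<Rightarrow> bool" where
  "splits p \<longleftrightarrow> (\<exists>c xs. p = Polynomial.smult c (\<Prod>x\<leftarrow>xs. [:- x, 1:]))"

definition radically_closed :: "'a::field itself \<Rightarrow> bool" where
  "radically_closed _ \<longleftrightarrow> (\<forall>n\<ge>2. \<forall>a::'a. splits (monom 1 n - [:a:]))"

definition decomposition ::
    "nat \<Rightarrow> nat \<Rightarrow> 'a::comm_ring_1 poly \<Rightarrow> 'a poly \<Rightarrow> 'a poly \<Rightarrow> bool" where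
  "decomposition q r P Q R \<longleftrightarrow>
     q \<ge> 2 \<and> r \<ge> 2 \<and> degree Q = q \<and> degree R = r \<and> P = Q \<circ>\<^sub>p R"

definition mu_poly :: "'a::comm_ring_1 poly \<Rightarrow> bool" where
  "mu_poly p \<longleftrightarrow> degree p > 0 \<and> lead_coeff p = 1"

definition nu_poly :: "'a::comm_ring_1 poly \<Rightarrow> bool" where
  "nu_poly p \<longleftrightarrow> degree p > 0 \<and> poly p 0 = 0"

definition rho_poly :: "'a::comm_ring_1 poly \<Rightarrow> bool" where
  "rho_poly p \<longleftrightarrow> degree p > 0 \<and>
     ((\<exists>a d. a \<noteq> 0 \<and> p = monom a d) \<or>
      (\<exists>(a :: nat \<Rightarrow> 'a) d e. a d \<noteq> 0 \<and> a e \<noteq> 0 \<and> 1 \<le> e \<and> e + 2 \<le> d \<and>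
         p = monom (a d) d + (\<Sum>i=1..e. monom (a i) i)))"

text \<open>In the second form of a rho-polynomial, the index e is the degree of what
  remains after removing the leading term. The value is meaningful only for rho-polynomials.\<close>

definition descent :: "'a::comm_ring_1 poly \<Rightarrow> nat" where
  "descent p =
     (let lt = monom (lead_coeff p) (degree p)
      in if p = lt then degree p else degree p - degree (p - lt))"

definition normal_decomposition ::
    "nat \<Rightarrow> nat \<Rightarrow> 'a::comm_ring_1 poly \<Rightarrow> 'a poly \<Rightarrow> 'a poly \<Rightarrow> bool" where
  "normal_decomposition q r P Q R \<longleftrightarrow> decomposition q r P Q R \<and> mu_poly R \<and> nu_poly R"

end

theory Submission
  imports Defs
begin

text \<open>
  Everything rests on one estimate. If \<open>R\<close> and \<open>S\<close> are monic of degree \<open>r\<close> and differ by a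
  polynomial of degree \<open>s \<ge> 1\<close>, then \<open>R ^ q - S ^ q\<close> is \<open>R - S\<close> times a sum of \<open>q\<close> monic polynomials
  of degree \<open>(q - 1) * r\<close>; in characteristic \<open>0\<close> these do not cancel, so the product has
  degree \<open>(q - 1) * r + s\<close>. The terms of \<open>Q \<circ>\<^sub>p R\<close> below the leading power \<open>a R ^ q\<close> have degree at
  most \<open>(q - 1) * r\<close>, so they cannot interfere: \<open>Q \<circ>\<^sub>p R - a S ^ q\<close> has degree exactly
  \<open>(q - 1) * r + s\<close> and its leading coefficient is \<open>a q\<close> times that of \<open>R - S\<close>
  (lemma \<open>pcompose_minus_lead_power\<close>). Three choices of \<open>S\<close> give the theorem.

  For \<open>S\<close> the inner polynomial of a second normal decomposition of the same polynomial, the degree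
  would also be at most \<open>(q - 1) * r\<close>; hence the inner polynomial is unique, and then so is the outer one.

  For \<open>S\<close> an approximation of \<open>R\<close> with coefficients in the small field, the leading coefficient of
  \<open>R - S\<close> lies in the small field as well, because it is a quotient of two elements of it. Adding the
  leading term to \<open>S\<close> improves the approximation; starting from \<open>X ^ r\<close>, one arrives at \<open>R\<close> itself.
  The coefficients of \<open>Q\<close> are then read off from the top of the expansion in powers of \<open>R\<close>.

  For \<open>S = X ^ r \<noteq> R\<close>, the estimate says that the two leading exponents of \<open>Q \<circ>\<^sub>p R\<close> are as far apart
  as those of \<open>R\<close>. This gap is the descent, and being a \<open>\<rho>\<close>-polynomial means that it is at least \<open>2\<close>
  and that the constant term vanishes. If \<open>R = X ^ r\<close>, all exponents of \<open>Q \<circ>\<^sub>p R\<close> are multiples of \<open>r\<close>,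
  so its gap is at least \<open>r \<ge> 2\<close>.
\<close>

section \<open>The second term of a composition\<close>

text \<open>The difference factors as \<open>f - g\<close> times \<open>\<Sum>i. f ^ i * g ^ (q - 1 - i)\<close>, all of whose \<open>q\<close>
  summands are monic of the same degree.\<close>

lemma monic_power_diff:
  fixes f g :: "'a::idom poly"
  assumes f: "monic f" and g: "monic g" and deg: "degree f = degree g"
    and q: "of_nat q \<noteq> (0::'a)" and ne: "f \<noteq> g"
  shows "degree (f ^ q - g ^ q) = (q - 1) * degree g + degree (f - g)"
    and "lead_coeff (f ^ q - g ^ q) = of_nat q * lead_coeff (f - g)"
proof -
  obtain n where n: "q = Suc n"
    using q by (cases q) auto
  define S where "S = (\<Sum>i<q. f ^ i * g ^ (n - i))"
  have fac: "f ^ q - g ^ q = (f - g) * S"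
    unfolding S_def n by (rule diff_power_eq_sum)
  have f0: "f \<noteq> 0" and g0: "g \<noteq> 0"
    using f g by auto
  have term_deg: "degree (f ^ i * g ^ (n - i)) = n * degree g" if "i < q" for i
  proof -
    have "degree (f ^ i * g ^ (n - i)) = (i + (n - i)) * degree g"
      using f0 g0 by (simp add: degree_mult_eq degree_power_eq deg algebra_simps)
    then show ?thesis using that n by simp
  qed
  have term_monic: "monic (f ^ i * g ^ (n - i))" for i
    using f g by (simp only: lead_coeff_mult lead_coeff_power) simp
  have coeff: "coeff S (n * degree g) = of_nat q"
  proof -
    have "coeff S (n * degree g) = (\<Sum>i<q. coeff (f ^ i * g ^ (n - i)) (n * degree g))"
      unfolding S_def by (rule coeff_sum)
    also have "\<dots> = (\<Sum>i<q. 1)"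
      using term_deg term_monic by (intro sum.cong refl) (metis lessThan_iff)
    finally show ?thesis by simp
  qed
  have "degree S \<le> n * degree g"
    unfolding S_def using term_deg by (intro degree_sum_le) auto
  moreover have "n * degree g \<le> degree S"
    using coeff q by (intro le_degree) simp
  ultimately have degS: "degree S = n * degree g" by simp
  then have lcS: "lead_coeff S = of_nat q"
    using coeff by simp
  then have "S \<noteq> 0"
    using q by auto
  then show "degree (f ^ q - g ^ q) = (q - 1) * degree g + degree (f - g)"
    unfolding fac using ne degS n by (simp add: degree_mult_eq)
  show "lead_coeff (f ^ q - g ^ q) = of_nat q * lead_coeff (f - g)"
    unfolding fac lead_coeff_mult lcS by (rule mult.commute)
qed

definition reductum :: "'a::comm_ring_1 poly \<Rightarrow> 'a poly" where
  "reductum p = p - monom (lead_coeff p) (degree p)"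

lemma degree_reductum_le: "degree (reductum p) \<le> degree p - 1"
proof (rule degree_le, intro allI impI)
  fix i
  assume "degree p - 1 < i"
  then show "coeff (reductum p) i = 0"
    by (cases "i = degree p") (auto simp: reductum_def coeff_eq_0)
qed

lemma pcompose_monom: "monom c n \<circ>\<^sub>p p = Polynomial.smult c (p ^ n)"
  by (induction n) (simp_all add: monom_0 monom_Suc pcompose_pCons)

lemma degree_pcompose_minus_power_le:
  fixes Q R :: "'a::idom poly"
  shows "degree (Q \<circ>\<^sub>p R - Polynomial.smult (lead_coeff Q) (R ^ degree Q)) \<le> (degree Q - 1) * degree R"
proof -
  have "Q \<circ>\<^sub>p R - Polynomial.smult (lead_coeff Q) (R ^ degree Q) = reductum Q \<circ>\<^sub>p R"
    by (simp add: reductum_def pcompose_diff pcompose_monom)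
  then have "degree (Q \<circ>\<^sub>p R - Polynomial.smult (lead_coeff Q) (R ^ degree Q))
      = degree (reductum Q) * degree R"
    by (simp add: degree_pcompose)
  also have "\<dots> \<le> (degree Q - 1) * degree R"
    by (intro mult_right_mono degree_reductum_le) simp
  finally show ?thesis .
qed

text \<open>Since \<open>R - S\<close> is not constant, the difference of the \<open>q\<close>-th powers reaches above the degree
  \<open>(q - 1) * r\<close> that bounds the lower terms of \<open>Q \<circ>\<^sub>p R\<close>.\<close>

lemma pcompose_minus_lead_power:
  fixes Q R S :: "'a::idom poly"
  assumes R: "monic R" and S: "monic S" and deg: "degree R = degree S"
    and q: "of_nat (degree Q) \<noteq> (0::'a)" and diff: "degree (R - S) > 0"
  defines "D \<equiv> Q \<circ>\<^sub>p R - Polynomial.smult (lead_coeff Q) (S ^ degree Q)"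
  shows "degree D = (degree Q - 1) * degree S + degree (R - S)"
    and "lead_coeff D = lead_coeff Q * of_nat (degree Q) * lead_coeff (R - S)"
proof -
  define U where "U = Polynomial.smult (lead_coeff Q) (R ^ degree Q - S ^ degree Q)"
  define V where "V = Q \<circ>\<^sub>p R - Polynomial.smult (lead_coeff Q) (R ^ degree Q)"
  have ne: "R \<noteq> S"
    using diff by auto
  have Q0: "lead_coeff Q \<noteq> 0"
    using q by auto
  have D: "D = U + V"
    by (simp add: D_def U_def V_def smult_diff_right)
  have degU: "degree U = (degree Q - 1) * degree S + degree (R - S)"
    using monic_power_diff(1)[OF R S deg q ne] Q0 by (simp add: U_def)
  have less: "degree V < degree U"
    using degree_pcompose_minus_power_le[of Q R] diff degU deg by (simp add: V_def)
  show "degree D = (degree Q - 1) * degree S + degree (R - S)"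
    using less degU by (simp add: D degree_add_eq_left)
  have "lead_coeff D = lead_coeff U"
    using less by (simp add: D degree_add_eq_left coeff_eq_0)
  also have "\<dots> = lead_coeff Q * lead_coeff (R ^ degree Q - S ^ degree Q)"
    unfolding U_def by (rule lead_coeff_smult)
  finally show "lead_coeff D = lead_coeff Q * of_nat (degree Q) * lead_coeff (R - S)"
    by (simp only: monic_power_diff(2)[OF R S deg q ne] mult.assoc)
qed

section \<open>Existence and uniqueness of the normal decomposition\<close>

lemma normal_decompositionD:
  assumes "normal_decomposition q r P Q R"
  shows "2 \<le> q" "2 \<le> r" "degree Q = q" "degree R = r" "P = Q \<circ>\<^sub>p R" "monic R" "coeff R 0 = 0"
  using assms
  by (auto simp: normal_decomposition_def decomposition_def mu_poly_def nu_poly_def poly_0_coeff_0)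

lemma lead_coeff_pcompose_monic:
  fixes Q R :: "'a::idom poly"
  assumes "monic R" "degree R > 0"
  shows "lead_coeff (Q \<circ>\<^sub>p R) = lead_coeff Q"
  by (simp only: lead_coeff_comp[OF assms(2)] assms(1) power_one mult_1_right)

text \<open>With \<open>c\<close> the leading coefficient and \<open>d\<close> the constant term of \<open>R\<close>, the inner polynomial
  \<open>(R - d) / c\<close> is normal, and the linear substitution \<open>c X + d\<close> is moved into \<open>Q\<close>.\<close>

lemma decomposition_imp_normal:
  fixes P :: "'a::field poly"
  assumes "decomposition q r P Q R"
  shows "\<exists>Q' R'. normal_decomposition q r P Q' R'"
proof (intro exI)
  define c where "c = lead_coeff R"
  define d where "d = coeff R 0"
  define R' where "R' = Polynomial.smult (inverse c) (R - [:d:])"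
  have q: "q \<ge> 2" and r: "r \<ge> 2" and dQ: "degree Q = q" and dR: "degree R = r"
    and P: "P = Q \<circ>\<^sub>p R"
    using assms by (auto simp: decomposition_def)
  have c0: "c \<noteq> 0"
    using dR r by (auto simp: c_def)
  have "degree (R - [:d:]) = degree R"
    using dR r by (simp only: diff_conv_add_uminus) (simp add: degree_add_eq_left)
  then have dR': "degree R' = r"
    using c0 dR by (simp add: R'_def)
  have "coeff R' r = 1"
    using c0 r dR by (cases r) (auto simp: R'_def c_def)
  moreover have "coeff R' 0 = 0"
    by (simp add: R'_def d_def)
  moreover have "[:d, c:] \<circ>\<^sub>p R' = R"
    using c0 by (simp add: pcompose_pCons R'_def)
  then have "P = (Q \<circ>\<^sub>p [:d, c:]) \<circ>\<^sub>p R'"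
    by (simp add: P pcompose_assoc[symmetric])
  moreover have "degree (Q \<circ>\<^sub>p [:d, c:]) = q"
    using c0 dQ by (simp add: degree_pcompose)
  ultimately show "normal_decomposition q r P (Q \<circ>\<^sub>p [:d, c:]) R'"
    using q r dR' by (simp add: normal_decomposition_def decomposition_def mu_poly_def
        nu_poly_def poly_0_coeff_0)
qed

lemma degree_diff_pos:
  fixes R S :: "'a::ab_group_add poly"
  assumes "coeff R 0 = coeff S 0" "R \<noteq> S"
  shows "degree (R - S) > 0"
proof (rule ccontr)
  assume "\<not> degree (R - S) > 0"
  then obtain c where "R - S = [:c:]"
    using degree_eq_zeroE by blast
  moreover have "coeff (R - S) 0 = 0"
    using assms(1) by simp
  ultimately show False
    using assms(2) by simp
qed

lemma normal_decomposition_unique: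
  fixes P :: "'a::idom poly"
  assumes 1: "normal_decomposition q r P Q R" and 2: "normal_decomposition q r P Q' R'"
    and q: "of_nat q \<noteq> (0::'a)"
  shows "Q = Q'" "R = R'"
proof -
  note n1 = normal_decompositionD[OF 1] and n2 = normal_decompositionD[OF 2]
  have "lead_coeff (Q \<circ>\<^sub>p R) = lead_coeff Q" "lead_coeff (Q' \<circ>\<^sub>p R') = lead_coeff Q'"
    using n1 n2 by (intro lead_coeff_pcompose_monic; simp)+
  then have lc: "lead_coeff Q = lead_coeff Q'"
    using n1(5) n2(5) by metis
  show R: "R = R'"
  proof (rule ccontr)
    assume "R \<noteq> R'"
    then have pos: "degree (R - R') > 0"
      using n1 n2 by (intro degree_diff_pos) simp_all
    have "degree (P - Polynomial.smult (lead_coeff Q) (R' ^ q)) = (q - 1) * r + degree (R - R')"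
      using pcompose_minus_lead_power(1)[of R R' Q] n1 n2 pos q by simp
    moreover have "degree (P - Polynomial.smult (lead_coeff Q) (R' ^ q)) \<le> (q - 1) * r"
      using degree_pcompose_minus_power_le[of Q' R'] n2 lc by simp
    ultimately show False
      using pos by simp
  qed
  have "(Q - Q') \<circ>\<^sub>p R = 0"
    using n1(5) n2(5) R by (simp add: pcompose_diff)
  then show "Q = Q'"
    using n1(2,4) pcompose_eq_0[of "Q - Q'" R] by simp
qed

section \<open>Coefficients of the normal decomposition\<close>

context field_hom
begin

interpretation map_poly_hom: map_poly_inj_idom_hom hom ..

lemma reductum_map_poly: "reductum (map_poly hom p) = map_poly hom (reductum p)"
  by (simp add: reductum_def hom_distribs)

text \<open>The given approximation \<open>T\<close> agrees with \<open>R\<close> in all coefficients above the degree of \<open>R - T\<close>.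
  The next coefficient of \<open>R\<close> is determined by that of \<open>Q \<circ>\<^sub>p R - a T ^ q\<close> through division by
  \<open>a q\<close>. The constant term is kept at zero so that the estimate applies at every step.\<close>

lemma inner_in_range_aux:
  fixes Q R :: "'b poly" and T :: "'a poly"
  assumes QR: "Q \<circ>\<^sub>p R = map_poly hom P"
    and R: "monic R" "degree R > 0" "coeff R 0 = 0"
    and q: "of_nat (degree Q) \<noteq> (0::'b)"
    and T: "monic T" "degree T = degree R" "coeff T 0 = 0"
  shows "R \<in> range (map_poly hom)"
  using T
proof (induction "degree (R - map_poly hom T)" arbitrary: T rule: less_induct)
  case less
  define S where "S = map_poly hom T"
  show ?case
  proof (cases "R = S")
    case True
    then show ?thesis by (simp add: S_def)
  next
    case False
    define s where "s = degree (R - S)"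
    have S: "monic S" "degree S = degree R" "coeff S 0 = 0"
      using less.prems by (simp_all add: S_def)
    have s0: "s > 0"
      using degree_diff_pos[of R S] R S False by (simp add: s_def)
    have s_less: "s < degree R"
    proof -
      have "s \<le> degree R"
        unfolding s_def using degree_diff_le_max[of R S] S by simp
      moreover have "coeff (R - S) (degree R) = 0"
        using R S by simp
      moreover have "lead_coeff (R - S) \<noteq> 0"
        unfolding leading_coeff_0_iff using False by simp
      ultimately show ?thesis
        unfolding s_def by (metis le_neq_implies_less)
    qed
    have lcP: "hom (lead_coeff P) = lead_coeff Q"
      using lead_coeff_pcompose_monic[of R Q] R QR by simp
    define D where "D = P - Polynomial.smult (lead_coeff P) (T ^ degree Q)"
    have "map_poly hom D = Q \<circ>\<^sub>p R - Polynomial.smult (lead_coeff Q) (S ^ degree Q)"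
      unfolding D_def S_def QR lcP[symmetric] by (simp add: hom_distribs)
    moreover have "lead_coeff (Q \<circ>\<^sub>p R - Polynomial.smult (lead_coeff Q) (S ^ degree Q))
        = lead_coeff Q * of_nat (degree Q) * lead_coeff (R - S)"
      using R S q s0 unfolding s_def by (intro pcompose_minus_lead_power(2)) simp_all
    ultimately have "hom (lead_coeff D) = lead_coeff Q * of_nat (degree Q) * lead_coeff (R - S)"
      by (metis hom_lead_coeff)
    moreover have "lead_coeff Q \<noteq> 0"
      using q by auto
    ultimately have "lead_coeff (R - S) = hom (lead_coeff D / (lead_coeff P * of_nat (degree Q)))"
      using q by (simp add: hom_distribs lcP field_simps)
    then obtain c where c: "lead_coeff (R - S) = hom c" by blast
    define T' where "T' = T + monom c s"
    have deg_monom: "degree (monom c s) < degree T"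
      using s_less less.prems degree_monom_le[of c s] by simp
    have T': "degree T' = degree R" "monic T'" "coeff T' 0 = 0"
      using deg_monom less.prems s0 s_less by (auto simp: T'_def degree_add_eq_left)
    have red: "R - map_poly hom T' = reductum (R - S)"
      by (simp add: T'_def S_def reductum_def hom_distribs s_def[unfolded S_def]
          c[unfolded S_def, symmetric])
    have "degree (R - map_poly hom T') < degree (R - map_poly hom T)"
      using degree_reductum_le[of "R - S"] s0 unfolding red s_def S_def by simp
    then show ?thesis
      using less.hyps T' by blast
  qed
qed

lemma inner_in_range:
  fixes Q R :: "'b poly"
  assumes "Q \<circ>\<^sub>p R = map_poly hom P" "monic R" "degree R > 0" "coeff R 0 = 0"
    "of_nat (degree Q) \<noteq> (0::'b)"
  shows "R \<in> range (map_poly hom)"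
  using assms
  by (intro inner_in_range_aux[where T = "monom 1 (degree R)"]) (auto simp: degree_monom_eq)

text \<open>The leading coefficient of \<open>Q\<close> is that of the composition, and removing the leading term of \<open>Q\<close>
  changes the composition by a polynomial over the small field.\<close>

lemma outer_in_range:
  fixes Q :: "'b poly"
  assumes R: "monic R" "degree R > 0" and QR: "Q \<circ>\<^sub>p map_poly hom R = map_poly hom P"
  shows "Q \<in> range (map_poly hom)"
  using QR
proof (induction "degree Q" arbitrary: Q P rule: less_induct)
  case less
  have lc: "lead_coeff Q = hom (lead_coeff P)"
    using lead_coeff_pcompose_monic[of "map_poly hom R" Q] R less.prems by simp
  show ?case
  proof (cases "degree Q = 0")
    case True
    then obtain c where "Q = [:c:]" by (rule degree_eq_zeroE)
    then have "Q = map_poly hom [:lead_coeff P:]"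
      using lc by (simp add: hom_distribs)
    then show ?thesis by blast
  next
    case False
    have "reductum Q \<circ>\<^sub>p map_poly hom R
        = map_poly hom (P - Polynomial.smult (lead_coeff P) (R ^ degree Q))"
      using less.prems lc
      by (simp add: reductum_def pcompose_diff pcompose_monom hom_distribs)
    moreover have "degree (reductum Q) < degree Q"
      using degree_reductum_le[of Q] False by simp
    ultimately obtain Q' where "reductum Q = map_poly hom Q'"
      using less.hyps by blast
    then have "Q = map_poly hom (Q' + monom (lead_coeff P) (degree Q))"
      using lc by (simp add: hom_distribs reductum_def algebra_simps)
    then show ?thesis by blast
  qed
qed

lemma normal_decomposition_in_range:
  fixes Q R :: "'b poly"
  assumes "normal_decomposition q r (map_poly hom P) Q R" "of_nat q \<noteq> (0::'b)"
  shows "Q \<in> range (map_poly hom)" "R \<in> range (map_poly hom)"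
proof -
  note n = normal_decompositionD[OF assms(1)]
  show "R \<in> range (map_poly hom)"
    using inner_in_range[of Q R P] n assms(2) by simp
  then obtain R' where R': "R = map_poly hom R'" by blast
  show "Q \<in> range (map_poly hom)"
    using outer_in_range[of R' Q P] n R' by simp
qed

end

section \<open>Descents\<close>

lemma sum_monom_eq_poly:
  assumes "degree p \<le> e" "coeff p 0 = 0"
  shows "(\<Sum>i=1..e. monom (coeff p i) i) = p"
proof -
  have "p = (\<Sum>i\<le>e. monom (coeff p i) i)"
    using assms(1) by (simp add: poly_as_sum_of_monoms')
  also have "\<dots> = (\<Sum>i=1..e. monom (coeff p i) i)"
    using assms(2) by (intro sum.mono_neutral_right) (auto simp: not_le less_Suc_eq)
  finally show ?thesis ..
qed

text \<open>From degree \<open>2\<close> on, the two shapes of a \<open>\<rho>\<close>-polynomial merge: a monomial has reductum \<open>0\<close>,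
  whose degree is \<open>0\<close>, and otherwise the degree \<open>e\<close> of the reductum satisfies \<open>e \<ge> 1\<close> because the
  constant term vanishes.\<close>

lemma rho_poly_iff:
  assumes deg: "degree p \<ge> 2"
  shows "rho_poly p \<longleftrightarrow> coeff p 0 = 0 \<and> degree (reductum p) + 2 \<le> degree p"
proof
  assume "rho_poly p"
  then consider (monom) a d where "a \<noteq> 0" "p = monom a d"
    | (gap) a d e where "a d \<noteq> 0" "a e \<noteq> 0" "1 \<le> e" "e + 2 \<le> d"
      "p = monom (a d) d + (\<Sum>i=1..e. monom (a i) i)"
    unfolding rho_poly_def by blast
  then show "coeff p 0 = 0 \<and> degree (reductum p) + 2 \<le> degree p"
  proof cases
    case monom
    then show ?thesis
      using deg by (auto simp: reductum_def degree_monom_eq)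
  next
    case gap
    define t where "t = (\<Sum>i=1..e. monom (a i) i)"
    have deg_t: "degree t \<le> e"
      unfolding t_def by (intro degree_sum_le) (auto intro: order_trans[OF degree_monom_le])
    have p: "p = monom (a d) d + t"
      using gap by (simp add: t_def)
    have dp: "degree p = d"
      unfolding p using gap deg_t by (subst degree_add_eq_left) (simp_all add: degree_monom_eq)
    have "coeff t d = 0"
      using deg_t gap by (intro coeff_eq_0) simp
    then have "reductum p = t"
      unfolding reductum_def dp by (simp add: p)
    moreover have "coeff t 0 = 0"
      unfolding t_def coeff_sum by (intro sum.neutral) auto
    ultimately show ?thesis
      using gap deg_t dp by (simp add: p)
  qed
next
  assume *: "coeff p 0 = 0 \<and> degree (reductum p) + 2 \<le> degree p"
  define t where "t = reductum p"
  define d where "d = degree p"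
  define e where "e = degree t"
  have p: "p = monom (coeff p d) d + t"
    by (simp add: t_def d_def reductum_def)
  have cp: "coeff p d \<noteq> 0"
    using deg by (auto simp: d_def)
  show "rho_poly p"
  proof (cases "t = 0")
    case True
    then have "p = monom (coeff p d) d"
      using p by simp
    then show ?thesis
      using deg cp unfolding rho_poly_def by auto
  next
    case False
    have t0: "coeff t 0 = 0"
      using * deg by (simp add: t_def reductum_def)
    have e: "1 \<le> e" "e + 2 \<le> d"
      using degree_diff_pos[of t 0] False t0 * by (simp_all add: e_def d_def t_def)
    have t: "coeff t i = coeff p i" if "i \<noteq> d" for i
      using that by (simp add: t_def reductum_def d_def)
    have "t = (\<Sum>i=1..e. monom (coeff t i) i)"
      using sum_monom_eq_poly[of t e] t0 by (simp add: e_def)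
    also have "\<dots> = (\<Sum>i=1..e. monom (coeff p i) i)"
      using e by (intro sum.cong refl) (auto simp: t)
    finally have "p = monom (coeff p d) d + (\<Sum>i=1..e. monom (coeff p i) i)"
      using p by simp
    moreover have "coeff p e \<noteq> 0"
      using t[of e] e leading_coeff_neq_0[OF False] by (simp add: e_def)
    ultimately show ?thesis
      using cp e deg unfolding rho_poly_def by (intro conjI disjI2 exI[of _ "coeff p"] exI) auto
  qed
qed

lemma descent_altdef:
  "descent p = (if reductum p = 0 then degree p else degree p - degree (reductum p))"
  by (simp add: descent_def reductum_def Let_def)

text \<open>Taking the approximation \<open>X ^ r\<close> of \<open>R\<close> subtracts exactly the leading term from \<open>Q \<circ>\<^sub>p R\<close>.\<close>

lemma degree_reductum_pcompose:
  fixes Q R :: "'a::idom poly"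
  assumes R: "monic R" "degree R > 0" "coeff R 0 = 0" "R \<noteq> monom 1 (degree R)"
    and q: "of_nat (degree Q) \<noteq> (0::'a)"
  shows "degree (reductum (Q \<circ>\<^sub>p R)) = (degree Q - 1) * degree R + degree (reductum R)"
proof -
  define X where "X = monom (1::'a) (degree R)"
  have X: "monic X" "degree X = degree R" "coeff X 0 = 0"
    using R by (simp_all add: X_def degree_monom_eq)
  have "lead_coeff (Q \<circ>\<^sub>p R) = lead_coeff Q"
    using R by (intro lead_coeff_pcompose_monic)
  then have "reductum (Q \<circ>\<^sub>p R) = Q \<circ>\<^sub>p R - Polynomial.smult (lead_coeff Q) (X ^ degree Q)"
    unfolding reductum_def X_def
    by (simp add: degree_pcompose monom_power smult_monom mult.commute)
  moreover have "reductum R = R - X"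
    using R by (simp add: reductum_def X_def)
  moreover have "degree (R - X) > 0"
    using degree_diff_pos[of R X] R X by (simp add: X_def)
  then have "degree (Q \<circ>\<^sub>p R - Polynomial.smult (lead_coeff Q) (X ^ degree Q))
      = (degree Q - 1) * degree X + degree (R - X)"
    using R(1) X(1,2) q by (intro pcompose_minus_lead_power(1)) simp_all
  ultimately show ?thesis
    by (simp only: X(2))
qed

lemma degree_reductum_pcompose_monom_le:
  fixes Q :: "'a::idom poly"
  assumes "r > 0"
  shows "degree (reductum (Q \<circ>\<^sub>p monom 1 r)) \<le> (degree Q - 1) * r"
proof -
  let ?R = "monom (1::'a) r"
  have R: "monic ?R" "degree ?R = r"
    by (simp_all add: degree_monom_eq)
  then have "lead_coeff (Q \<circ>\<^sub>p ?R) = lead_coeff Q"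
    using assms by (intro lead_coeff_pcompose_monic) simp_all
  then have "reductum (Q \<circ>\<^sub>p ?R) = Q \<circ>\<^sub>p ?R - Polynomial.smult (lead_coeff Q) (?R ^ degree Q)"
    unfolding reductum_def using R
    by (simp add: degree_pcompose monom_power smult_monom mult.commute)
  then show ?thesis
    using degree_pcompose_minus_power_le[of Q ?R] R by simp
qed

text \<open>For \<open>R = X ^ r\<close> the leading exponent exceeds all others by at least \<open>r \<ge> 2\<close> in both \<open>P\<close> and \<open>R\<close>;
  otherwise the two gaps are equal.\<close>

lemma rho_poly_pcompose_iff:
  fixes Q R :: "'a::idom poly"
  assumes n: "normal_decomposition q r P Q R" and q: "of_nat q \<noteq> (0::'a)"
  shows "rho_poly P \<longleftrightarrow> coeff P 0 = 0 \<and> rho_poly R"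
proof -
  note n = normal_decompositionD[OF n]
  have deg: "degree P = (q - 1) * r + r"
    using n by (cases q) (simp_all add: degree_pcompose)
  then have rho_P: "rho_poly P \<longleftrightarrow> coeff P 0 = 0 \<and> degree (reductum P) + 2 \<le> degree P"
    using n(2) by (intro rho_poly_iff) simp
  have rho_R: "rho_poly R \<longleftrightarrow> degree (reductum R) + 2 \<le> r"
    using rho_poly_iff[of R] n by simp
  show ?thesis
  proof (cases "R = monom 1 r")
    case True
    have "degree (reductum P) + 2 \<le> degree P"
      using degree_reductum_pcompose_monom_le[of r Q] deg n True by simp
    moreover have "reductum R = 0"
      unfolding True by (simp add: reductum_def degree_monom_eq)
    ultimately show ?thesis
      unfolding rho_P rho_R using n(2) by simp
  next
    case False
    then have "degree (reductum P) = (q - 1) * r + degree (reductum R)"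
      using degree_reductum_pcompose[of R Q] n q by simp
    then show ?thesis
      unfolding rho_P rho_R deg by auto
  qed
qed

lemma descent_pcompose:
  fixes Q R :: "'a::idom poly"
  assumes n: "normal_decomposition q r P Q R" and q: "of_nat q \<noteq> (0::'a)"
    and R: "R \<noteq> monom 1 r"
  shows "descent P = descent R"
proof -
  note n = normal_decompositionD[OF n]
  have deg: "degree P = (q - 1) * r + r"
    using n by (cases q) (simp_all add: degree_pcompose)
  have red: "degree (reductum P) = (q - 1) * r + degree (reductum R)"
    using degree_reductum_pcompose[of R Q] n q R by simp
  have "reductum R \<noteq> 0"
    using R n by (auto simp: reductum_def)
  moreover have "(q - 1) * r > 0"
    using n by simp
  then have "reductum P \<noteq> 0"
    using red by auto
  ultimately show ?thesis
    using n(4) by (simp add: descent_altdef deg red)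
qed

section \<open>Transfer along the field extension\<close>

text \<open>The \<open>\<rho>\<close>-property and the descent are compared over the large field, where \<open>Q\<close> and \<open>R\<close> live.
  An embedding preserves degrees and reducta, hence both notions; it also makes the characteristic
  of the large field \<open>0\<close>. The degree bound in \<open>rho_poly_iff\<close> holds since \<open>q r \<ge> 4\<close>.\<close>

theorem theorem3p3:
  fixes h :: "'k::field_char_0 \<Rightarrow> 'l::field" and P :: "'k poly" and q r :: nat
  assumes "radically_closed TYPE('k)"
    and "field_hom h"
  shows
    "((\<exists>Q R. decomposition q r (map_poly h P) Q R) \<longrightarrow>
        (\<exists>!QR. normal_decomposition q r (map_poly h P) (fst QR) (snd QR)) \<and>
        (\<forall>Q R. normal_decomposition q r (map_poly h P) Q R \<longrightarrow>
           Q \<in> range (map_poly h) \<and> R \<in> range (map_poly h))) \<and>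
     (\<forall>Q R. normal_decomposition q r (map_poly h P) Q R \<longrightarrow>
        (mu_poly P \<longleftrightarrow> mu_poly Q) \<and>
        (nu_poly P \<longleftrightarrow> nu_poly Q) \<and>
        (rho_poly P \<longrightarrow> rho_poly R) \<and>
        (nu_poly P \<longrightarrow> (rho_poly P \<longleftrightarrow> rho_poly R)) \<and>
        (rho_poly P \<longrightarrow> R \<noteq> monom 1 r \<longrightarrow> descent P = descent R))"
proof -
  interpret field_hom h
    by (rule assms(2))
  have char: "of_nat n \<noteq> (0::'l)" if "n \<ge> 2" for n
    using that hom_0_iff[of "of_nat n"] by (simp add: hom_of_nat)
  let ?P = "map_poly h P"
  have a: "(\<exists>!QR. normal_decomposition q r ?P (fst QR) (snd QR)) \<and>
      (\<forall>Q R. normal_decomposition q r ?P Q R \<longrightarrow>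
         Q \<in> range (map_poly h) \<and> R \<in> range (map_poly h))"
    if ex: "\<exists>Q R. decomposition q r ?P Q R"
  proof
    have q: "of_nat q \<noteq> (0::'l)"
      using ex char by (auto simp: decomposition_def)
    obtain Q R where QR: "normal_decomposition q r ?P Q R"
      using ex decomposition_imp_normal by blast
    show "\<exists>!QR. normal_decomposition q r ?P (fst QR) (snd QR)"
    proof (rule ex1I[of _ "(Q, R)"])
      show "normal_decomposition q r ?P (fst (Q, R)) (snd (Q, R))"
        using QR by simp
      show "QR' = (Q, R)" if "normal_decomposition q r ?P (fst QR') (snd QR')" for QR'
        using normal_decomposition_unique[OF that QR q] by (simp add: prod_eq_iff)
    qed
    show "\<forall>Q R. normal_decomposition q r ?P Q R \<longrightarrow>
         Q \<in> range (map_poly h) \<and> R \<in> range (map_poly h)"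
      by (intro allI impI conjI; rule normal_decomposition_in_range[OF _ q])
  qed
  have b: "(mu_poly P \<longleftrightarrow> mu_poly Q) \<and>
        (nu_poly P \<longleftrightarrow> nu_poly Q) \<and>
        (rho_poly P \<longrightarrow> rho_poly R) \<and>
        (nu_poly P \<longrightarrow> (rho_poly P \<longleftrightarrow> rho_poly R)) \<and>
        (rho_poly P \<longrightarrow> R \<noteq> monom 1 r \<longrightarrow> descent P = descent R)"
    if nd: "normal_decomposition q r ?P Q R" for Q R
  proof -
    note n = normal_decompositionD[OF nd]
    have q: "of_nat q \<noteq> (0::'l)"
      using char n(1) by simp
    have "degree ?P = q * r"
      unfolding n(5) by (simp add: degree_pcompose n(3,4))
    then have deg: "degree P = q * r"
      by simp
    have "2 * 2 \<le> q * r"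
      using n(1,2) by (rule mult_le_mono)
    then have deg2: "degree P \<ge> 2"
      using deg by simp
    have "lead_coeff ?P = lead_coeff Q"
      unfolding n(5) using n(2,4,6) by (intro lead_coeff_pcompose_monic) simp_all
    then have lc: "lead_coeff Q = h (lead_coeff P)"
      by simp
    have "coeff ?P 0 = poly Q 0"
      unfolding n(5) by (simp add: n(7))
    then have c0: "poly Q 0 = h (coeff P 0)"
      by simp
    have mu: "mu_poly P \<longleftrightarrow> mu_poly Q"
      using lc n(1,3) deg2 by (simp add: mu_poly_def)
    have nu: "nu_poly P \<longleftrightarrow> nu_poly Q"
      using c0 n(1,3) deg2 by (simp add: nu_poly_def poly_0_coeff_0)
    have rho_map: "rho_poly ?P \<longleftrightarrow> rho_poly P"
      using rho_poly_iff[of P] rho_poly_iff[of ?P] deg2 by (simp add: reductum_map_poly)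
    have rho: "rho_poly P \<longleftrightarrow> nu_poly P \<and> rho_poly R"
      using rho_poly_pcompose_iff[OF nd q] deg2 unfolding rho_map
      by (simp add: nu_poly_def poly_0_coeff_0)
    have "descent ?P = descent P"
      by (simp add: descent_altdef reductum_map_poly)
    then have "descent P = descent R" if "R \<noteq> monom 1 r"
      using descent_pcompose[OF nd q that] by simp
    then show ?thesis
      using mu nu rho by blast
  qed
  show ?thesis
    by (rule conjI, rule impI, erule a, intro allI impI, erule b)
qed

end
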